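(* Let $f(z)=z+\sum_{n\ge 2}a_nz^n$ belong to $\mathcal{S}^*_B$, and let $\mathcal{T}_{2,1}(f)=1-a_2^2$. Then $$|\mathcal{T}_{2,1}(f)|\le 2.$$ This inequality is sharp, i.e. equality holds for some function in $\mathcal{S}^*_B$.
   Context: Let $\mathbb{D}=\{z\in\mathbb{C}:|z|<1\}$ and let $\mathcal{A}$ be the class of analytic functions $f$ on $\mathbb{D}$ with $f(0)=0$, $f'(0)=1$, written $f(z)=z+\sum_{n=2}^\infty a_nz^n$. For analytic functions $g,h$ on $\mathbb{D}$, $g\prec h$ ($g$ is subordinate to $h$) means $g(z)=h(w(z))$ on $\mathbb{D}$ for some analytic $w:\mathbb{D}\to\mathbb{D}$ with $w(0)=0$. Let $B(z)=\dfrac{1}{1-\log(1+z)}$ on $\mathbb{D}$ (principal branch of the logarithm), and let $$\mathcal{S}^*_B=\left\{f\in\mathcal{A}:\ \frac{zf'(z)}{f(z)}\prec B(z)\right\}.$$ *)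

theory Defs
  imports "HOL-Complex_Analysis.Complex_Analysis"
begin

abbreviation unit_disk :: "complex set" ("\<D>") where
  "\<D> \<equiv> ball 0 1"

definition class_A :: "(complex \<Rightarrow> complex) set" where
  "class_A = {f. f holomorphic_on \<D> \<and> f 0 = 0 \<and> deriv f 0 = 1}"

definition taylor_coeff :: "(complex \<Rightarrow> complex) \<Rightarrow> nat \<Rightarrow> complex" where
  "taylor_coeff f n = (deriv ^^ n) f 0 / fact n"

text \<open>Used only for functions \<open>g\<close>, \<open>h\<close> that are holomorphic on the unit disk.\<close>

definition subordinate :: "(complex \<Rightarrow> complex) \<Rightarrow> (complex \<Rightarrow> complex) \<Rightarrow> bool"
    (infix "\<prec>\<^sub>s" 50) where
  "g \<prec>\<^sub>s h \<longleftrightarrow>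
     (\<exists>w. w holomorphic_on \<D> \<and> w ` \<D> \<subseteq> \<D> \<and> w 0 = 0 \<and> (\<forall>z\<in>\<D>. g z = h (w z)))"

definition B_fun :: "complex \<Rightarrow> complex" where
  "B_fun z = 1 / (1 - Ln (1 + z))"

text \<open>
  For \<open>f\<close> in \<open>class_A\<close> the quotient \<open>z f'(z) / f(z)\<close> has a removable singularity at the
  origin, where the analytic extension takes the value \<open>1\<close>; HOL's totalised division
  would give \<open>0\<close> there.
\<close>

definition starlike_quotient :: "(complex \<Rightarrow> complex) \<Rightarrow> complex \<Rightarrow> complex" where
  "starlike_quotient f z = (if z = 0 then 1 else z * deriv f z / f z)"

text \<open>
  The condition that \<open>f\<close> has no zero in the punctured disk makes explicit that the
  quotient is an analytic function on the whole disk.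
\<close>

definition S_star_B :: "(complex \<Rightarrow> complex) set" where
  "S_star_B = {f \<in> class_A. (\<forall>z \<in> \<D> - {0}. f z \<noteq> 0) \<and> starlike_quotient f \<prec>\<^sub>s B_fun}"

definition T21 :: "(complex \<Rightarrow> complex) \<Rightarrow> complex" where
  "T21 f = 1 - (taylor_coeff f 2)\<^sup>2"

end

theory Submission
  imports Defs
begin

text \<open>
  If \<open>z f'(z) = f(z) B(w(z))\<close>, comparing second derivatives at the origin gives
  \<open>a\<^sub>2 = B'(0) w'(0) = w'(0)\<close>, and \<open>\<bar>w'(0)\<bar> \<le> 1\<close> by the Schwarz lemma. The choice
  \<open>w(z) = \<i> z\<close> gives \<open>a\<^sub>2\<^sup>2 = -1\<close>, so equality holds.
\<close>

text \<open>By the Leibniz rule the second derivatives of the two sides at the origin are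
  \<open>2 f''(0)\<close> and \<open>f''(0) + 2 h'(0)\<close>, so
  \<open>f''(0) / 2 = h'(0)\<close>.\<close>

lemma taylor_coeff_2_of_log_deriv:
  assumes f: "f holomorphic_on \<D>" and h: "h holomorphic_on \<D>"
    and f0: "f 0 = 0" and f1: "deriv f 0 = 1" and h0: "h 0 = 1"
    and eq: "\<And>z. z \<in> \<D> \<Longrightarrow> z * deriv f z = f z * h z"
  shows "taylor_coeff f 2 = deriv h 0"
proof -
  have f': "deriv f holomorphic_on \<D>" using f by (simp add: holomorphic_deriv)
  have "(deriv ^^ 2) (\<lambda>z. z * deriv f z) 0 = (deriv ^^ 2) (\<lambda>z. f z * h z) 0"
    by (intro higher_deriv_cong_ev refl eventually_mono[OF eventually_nhds_in_open[of \<D> 0]] eq) auto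
  moreover have "(deriv ^^ 2) (\<lambda>z. z * deriv f z) 0 = 2 * deriv (deriv f) 0"
    using higher_deriv_mult[OF holomorphic_on_ident f', of 0 2]
    by (simp add: numeral_2_eq_2)
  moreover have "(deriv ^^ 2) (\<lambda>z. f z * h z) 0 = deriv (deriv f) 0 + 2 * deriv h 0"
    using higher_deriv_mult[OF f h, of 0 2] f0 f1 h0 by (simp add: numeral_2_eq_2)
  ultimately show ?thesis
    by (simp add: taylor_coeff_def numeral_2_eq_2)
qed

text \<open>The real part of \<open>1 + z\<close> is positive, which keeps the argument of
  \<open>Ln\<close> in \<open>B_fun\<close> off the branch cut.\<close>

lemma one_plus_notin_nonpos_Reals:
  assumes "z \<in> \<D>"
  shows "1 + z \<notin> \<real>\<^sub>\<le>\<^sub>0"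
proof -
  have "\<bar>Re z\<bar> < 1" using abs_Re_le_cmod[of z] assms by simp
  thus ?thesis by (auto simp: complex_nonpos_Reals_iff)
qed

text \<open>The denominator of \<open>B_fun\<close> could vanish only at \<open>z = e - 1\<close>,
  and this point lies outside the disk because \<open>e \<ge> 2\<close>.\<close>

lemma Ln_one_plus_neq_1:
  assumes "z \<in> \<D>"
  shows "Ln (1 + z) \<noteq> 1"
proof
  assume *: "Ln (1 + z) = 1"
  have "1 + z \<noteq> 0" using one_plus_notin_nonpos_Reals[OF assms] by auto
  hence "z = of_real (exp 1 - 1)"
    using exp_Ln[of "1 + z"] by (simp add: * exp_of_real[symmetric] algebra_simps)
  hence "cmod z = \<bar>exp 1 - 1\<bar>" by (metis norm_of_real real_norm_def)
  moreover have "exp 1 \<ge> (2::real)" using exp_ge_add_one_self[of 1] by simp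
  ultimately show False using assms by simp
qed

lemma B_fun_holomorphic: "B_fun holomorphic_on \<D>"
  unfolding B_fun_def
  using one_plus_notin_nonpos_Reals Ln_one_plus_neq_1
  by (intro holomorphic_intros) force+

lemma B_fun_0 [simp]: "B_fun 0 = 1"
  by (simp add: B_fun_def)

lemma B_fun_deriv_0: "(B_fun has_field_derivative 1) (at 0)"
  unfolding B_fun_def[abs_def] by (auto intro!: derivative_eq_intros)

lemma deriv_B_fun_compose:
  assumes "w holomorphic_on \<D>" "w 0 = 0"
  shows "deriv (\<lambda>z. B_fun (w z)) 0 = deriv w 0"
proof -
  have "(w has_field_derivative deriv w 0) (at 0)"
    using assms(1) by (intro holomorphic_derivI[of _ \<D>]) auto
  thus ?thesis
    using DERIV_chain2[of B_fun 1 w 0] B_fun_deriv_0 assms(2)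
    by (intro DERIV_imp_deriv) simp
qed

lemma taylor_coeff_2_subordinate:
  assumes "f \<in> class_A" "w holomorphic_on \<D>" "w ` \<D> \<subseteq> \<D>" "w 0 = 0"
    and nz: "\<forall>z\<in>\<D> - {0}. f z \<noteq> 0"
    and q: "\<forall>z\<in>\<D>. starlike_quotient f z = B_fun (w z)"
  shows "taylor_coeff f 2 = deriv w 0"
proof -
  have f: "f holomorphic_on \<D>" "f 0 = 0" "deriv f 0 = 1"
    using assms(1) by (auto simp: class_A_def)
  have "(\<lambda>z. B_fun (w z)) holomorphic_on \<D>"
    using holomorphic_on_compose_gen[OF assms(2) B_fun_holomorphic assms(3)] by (simp add: o_def)
  moreover have "z * deriv f z = f z * B_fun (w z)" if "z \<in> \<D>" for z
    using bspec[OF q that] nz that f(2)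
    \<comment> \<open>At the origin both sides vanish since \<open>f 0 = 0\<close>; elsewhere
      \<open>f z\<close> is nonzero and the quotient can be cleared.\<close>
    by (cases "z = 0") (auto simp: starlike_quotient_def field_simps)
  ultimately have "taylor_coeff f 2 = deriv (\<lambda>z. B_fun (w z)) 0"
    using f assms(4) by (intro taylor_coeff_2_of_log_deriv) auto
  thus ?thesis using deriv_B_fun_compose assms(2,4) by simp
qed

text \<open>Solves the equation \<open>z f' = f h\<close> by \<open>f(z) = z exp(G(z))\<close> with
  \<open>G' = (h - 1) / z\<close>. This turns a chosen Schwarz function into a member of
  \<open>S_star_B\<close>, as sharpness requires.\<close>

lemma exists_with_starlike_quotient:
  assumes h: "h holomorphic_on \<D>" and h0: "h 0 = 1"
  obtains f where "f \<in> class_A" "\<forall>z\<in>\<D> - {0}. f z \<noteq> 0" "\<forall>z\<in>\<D>. starlike_quotient f z = h z"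
proof -
  \<comment> \<open>The analytic extension of \<open>(h z - 1) / z\<close> across its removable
    singularity, written in the shape that \<open>pole_lemma\<close> expects.\<close>
  define p where "p = (\<lambda>z. if z = 0 then deriv h 0 else (h z - h 0) / (z - 0))"
  have "p holomorphic_on \<D>"
    unfolding p_def using h by (intro pole_lemma) auto
  then obtain G0 where G0: "\<And>z. z \<in> \<D> \<Longrightarrow> (G0 has_field_derivative p z) (at z within \<D>)"
    by (rule holomorphic_convex_primitive'[OF convex_ball open_ball]) blast
  \<comment> \<open>Shifting the primitive so that \<open>G 0 = 0\<close> yields the normalisation
    \<open>deriv f 0 = exp (G 0) * h 0 = 1\<close>.\<close>
  define G where "G = (\<lambda>z. G0 z - G0 0)"
  have G: "(G has_field_derivative p z) (at z)" if "z \<in> \<D>" for z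
    unfolding G_def using DERIV_diff[OF G0[OF that] DERIV_const, of "G0 0"] that
    by (simp add: at_within_open[of _ "\<D>"])
  define f where "f = (\<lambda>z. z * exp (G z))"
  have f: "(f has_field_derivative exp (G z) * h z) (at z)" if "z \<in> \<D>" for z
  proof -
    \<comment> \<open>This also holds at \<open>z = 0\<close>, because \<open>h 0 = 1\<close>; hence
      the product rule gives \<open>exp (G z) * h z\<close> on the whole disk, origin
      included.\<close>
    have "z * p z = h z - 1" by (simp add: p_def h0)
    hence "exp (G z) * h z = exp (G z) + z * (exp (G z) * p z)" by algebra
    thus ?thesis unfolding f_def
      using DERIV_mult[OF DERIV_ident DERIV_fun_exp[OF G[OF that]]] by (simp add: mult_ac add_ac)
  qed
  have d: "deriv f z = exp (G z) * h z" if "z \<in> \<D>" for z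
    using f[OF that] by (rule DERIV_imp_deriv)
  have "f holomorphic_on \<D>"
    using f holomorphic_on_open[OF open_ball, of f] by blast
  hence "f \<in> class_A"
    by (simp add: class_A_def d h0) (simp add: f_def G_def)
  moreover have "\<forall>z\<in>\<D> - {0}. f z \<noteq> 0" by (simp add: f_def)
  moreover have "\<forall>z\<in>\<D>. starlike_quotient f z = h z"
    by (auto simp: starlike_quotient_def h0 d) (simp add: f_def)
  ultimately show ?thesis by (rule that)
qed

theorem theorem4p1:
  shows "(\<forall>f \<in> S_star_B. cmod (T21 f) \<le> 2) \<and> (\<exists>f \<in> S_star_B. cmod (T21 f) = 2)"
proof (intro conjI ballI)
  fix f assume "f \<in> S_star_B"
  then obtain w where f: "f \<in> class_A" "\<forall>z\<in>\<D> - {0}. f z \<noteq> 0"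
      "\<forall>z\<in>\<D>. starlike_quotient f z = B_fun (w z)"
    and w: "w holomorphic_on \<D>" "w ` \<D> \<subseteq> \<D>" "w 0 = 0"
    by (auto simp: S_star_B_def subordinate_def)
  have "cmod (deriv w 0) \<le> 1"
    using w Schwarz_Lemma(2)[of w 0] by (force simp: image_subset_iff)
  hence "cmod (taylor_coeff f 2) \<le> 1"
    using taylor_coeff_2_subordinate f w by simp
  hence "cmod ((taylor_coeff f 2)\<^sup>2) \<le> 1"
    by (simp add: norm_power power_le_one)
  thus "cmod (T21 f) \<le> 2"
    unfolding T21_def using norm_triangle_ineq4[of 1 "(taylor_coeff f 2)\<^sup>2"] by simp
next
  \<comment> \<open>Since the square of the coefficient has modulus at most 1, equality in the
    triangle inequality forces it to be -1, so \<open>deriv w 0\<close> must be \<open>\<i>\<close>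
    or its negative; a rotation achieves this.\<close>
  define w where "w = (\<lambda>z. \<i> * z)"
  have w: "w holomorphic_on \<D>" "w ` \<D> \<subseteq> \<D>" "w 0 = 0" "deriv w 0 = \<i>"
    by (auto simp: w_def norm_mult intro!: holomorphic_intros)
  have "(\<lambda>z. B_fun (w z)) holomorphic_on \<D>"
    using holomorphic_on_compose_gen[OF w(1) B_fun_holomorphic w(2)] by (simp add: o_def)
  then obtain f where f: "f \<in> class_A" "\<forall>z\<in>\<D> - {0}. f z \<noteq> 0"
      "\<forall>z\<in>\<D>. starlike_quotient f z = B_fun (w z)"
    using exists_with_starlike_quotient[of "\<lambda>z. B_fun (w z)"] w(3) by auto
  have "f \<in> S_star_B"
    using f w by (auto simp: S_star_B_def subordinate_def)
  moreover have "cmod (T21 f) = 2"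
    using taylor_coeff_2_subordinate[OF f(1) w(1,2,3) f(2,3)] w(4) by (simp add: T21_def)
  ultimately show "\<exists>f \<in> S_star_B. cmod (T21 f) = 2" by blast
qed

end
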